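(* There is a deterministic adaptive algorithm in the static multiple-access channel model (with collision detection) that finds a spanning forest $T$ of an input simple graph (with $n$ vertices and $m$ edges) in time $\mathcal{O}(\min\{m, |T|\log m\})$.
   Context: Model: the input is a simple graph $G$ (no edge weights) on vertex set $\{1,\dots,n\}$ with $m$ edges. There are $m$ stations with distinct IDs $1,\dots,m$; each station holds exactly one edge of $G$, and every edge is held by exactly one station. All stations know $n$; they do not know $m$. Computation is synchronous with a global clock. In each step every station either broadcasts a message (of arbitrary size) or not. If exactly one station broadcasts, its message is heard by all stations; if no station broadcasts, all stations hear silence; if two or more broadcast, all stations hear a collision signal distinct from silence (collision detection). In the static model all stations participate from the first step. An edge is revealed when it is heard on the channel. A spanning forest of $G$ is a maximal acyclic set of edges of $G$ (adding any further edge of $G$ creates a cycle); the algorithm finds a spanning forest $T$ if all edges of $T$ are revealed during the execution and then the execution terminates; $|T|$ is the number of edges of $T$. Time is the number of steps until termination. An algorithm is deterministic adaptive if each station's decision at each step is a deterministic function of $n$, its ID, its edge, and the channel feedback heard in previous steps. *)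

theory Defs
  imports Complex_Main
begin

type_synonym edge = "nat set"

definition simple_graph :: "nat \<Rightarrow> edge set \<Rightarrow> bool" where
  "simple_graph n E \<longleftrightarrow> (\<forall>e\<in>E. e \<subseteq> {1..n} \<and> card e = 2)"

definition is_cycle :: "edge set \<Rightarrow> nat list \<Rightarrow> bool" where
  "is_cycle F vs \<longleftrightarrow> 3 \<le> length vs \<and> distinct vs \<and>
     (\<forall>k<length vs. {vs ! k, vs ! (Suc k mod length vs)} \<in> F)"

definition acyclic_edges :: "edge set \<Rightarrow> bool" where
  "acyclic_edges F \<longleftrightarrow> (\<nexists>vs. is_cycle F vs)"

definition spanning_forest :: "edge set \<Rightarrow> edge set \<Rightarrow> bool" where
  "spanning_forest E T \<longleftrightarrow>
     T \<subseteq> E \<and> acyclic_edges T \<and> (\<forall>e\<in>E - T. \<not> acyclic_edges (insert e T))"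

(* Besides an arbitrary finite bit string, a message may explicitly announce an edge. *)
datatype message = Message (announced: "edge option") (payload: "bool list")

datatype feedback = Silence | Heard message | Collision

datatype decision = Listen | Broadcast message | Halt

(* The decision of a station as a function of n, its ID, its edge and the feedback of
   all previous steps (oldest first).  The number m of stations is not an argument. *)
type_synonym algorithm = "nat \<Rightarrow> nat \<Rightarrow> edge \<Rightarrow> feedback list \<Rightarrow> decision"

(* Below, m is the number of stations and \<sigma> i is the edge held by station i. *)

definition broadcasts ::
  "algorithm \<Rightarrow> nat \<Rightarrow> nat \<Rightarrow> (nat \<Rightarrow> edge) \<Rightarrow> feedback list \<Rightarrow> (nat \<times> message) set" where
  "broadcasts A n m \<sigma> h = {(i, x). i \<in> {1..m} \<and> A n i (\<sigma> i) h = Broadcast x}"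

definition channel :: "(nat \<times> message) set \<Rightarrow> feedback" where
  "channel B = (if B = {} then Silence
                else if is_singleton B then Heard (snd (the_elem B))
                else Collision)"

primrec history ::
  "algorithm \<Rightarrow> nat \<Rightarrow> nat \<Rightarrow> (nat \<Rightarrow> edge) \<Rightarrow> nat \<Rightarrow> feedback list" where
  "history A n m \<sigma> 0 = []"
| "history A n m \<sigma> (Suc t) =
     history A n m \<sigma> t @ [channel (broadcasts A n m \<sigma> (history A n m \<sigma> t))]"

(* The edges revealed in the first t steps.  An edge counts only if it is announced by the
   station that holds it: otherwise a station could reveal every edge by announcing all
   pairs of vertices. *)
definition revealed ::
  "algorithm \<Rightarrow> nat \<Rightarrow> nat \<Rightarrow> (nat \<Rightarrow> edge) \<Rightarrow> nat \<Rightarrow> edge set" where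
  "revealed A n m \<sigma> t =
     {\<sigma> i | i x s. s < t \<and> broadcasts A n m \<sigma> (history A n m \<sigma> s) = {(i, x)} \<and>
                   announced x = Some (\<sigma> i)}"

definition all_halt ::
  "algorithm \<Rightarrow> nat \<Rightarrow> nat \<Rightarrow> (nat \<Rightarrow> edge) \<Rightarrow> nat \<Rightarrow> bool" where
  "all_halt A n m \<sigma> t \<longleftrightarrow> (\<forall>i\<in>{1..m}. A n i (\<sigma> i) (history A n m \<sigma> t) = Halt)"

(* The execution consists of exactly t steps.  Termination is a joint event: all stations
   hear the same feedback and halt together, none of them earlier.  Without stations
   (m = 0) the execution consists of 0 steps. *)
definition terminates_after ::
  "algorithm \<Rightarrow> nat \<Rightarrow> nat \<Rightarrow> (nat \<Rightarrow> edge) \<Rightarrow> nat \<Rightarrow> bool" where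
  "terminates_after A n m \<sigma> t \<longleftrightarrow> all_halt A n m \<sigma> t \<and>
     (\<forall>s<t. \<not> all_halt A n m \<sigma> s \<and>
            (\<forall>i\<in>{1..m}. A n i (\<sigma> i) (history A n m \<sigma> s) \<noteq> Halt))"

definition finds_spanning_forest ::
  "algorithm \<Rightarrow> nat \<Rightarrow> edge set \<Rightarrow> (nat \<Rightarrow> edge) \<Rightarrow> edge set \<Rightarrow> nat \<Rightarrow> bool" where
  "finds_spanning_forest A n E \<sigma> T t \<longleftrightarrow>
     spanning_forest E T \<and> T \<subseteq> revealed A n (card E) \<sigma> t \<and>
     terminates_after A n (card E) \<sigma> t"

(* Logarithm inside asymptotic bounds.  It agrees with log 2 m for m \<ge> 2; for m = 1 the
   true logarithm is 0, although revealing the single edge takes at least one step. *)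
definition log_bound :: "nat \<Rightarrow> real" where
  "log_bound m = max 1 (log 2 (real m))"

end

theory Submission
  imports Defs
begin

text \<open>
  The binary expansions of the IDs form an infinite binary tree, which the algorithm traverses
  depth first, keeping a forest of the edges revealed so far. A station is active if its edge can
  be added to this forest. A node is visited by letting the active stations in its subtree
  broadcast. Silence or a single message settles the whole subtree, as an inactive station stays
  inactive; a collision makes the algorithm visit the node itself and both child subtrees.
  Thus every collision costs three further steps.
  Collisions occur only at nodes \<open>v \<le> m\<close>, and a collision at \<open>v\<close> implies that an edge is revealed
  below \<open>v\<close>, at depth at most \<open>log m\<close>. This gives both bounds, without knowledge of \<open>m\<close>.
\<close>

section \<open>Acyclic edge sets and spanning forests\<close>

lemma acyclic_edges_mono: "acyclic_edges G \<Longrightarrow> F \<subseteq> G \<Longrightarrow> acyclic_edges F"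
  unfolding acyclic_edges_def is_cycle_def by blast

text \<open>A cycle has three distinct vertices, so its first two edges share \<open>vs ! 1\<close>
  but differ in the other endpoint. They cannot both equal \<open>e\<close>.\<close>

lemma not_is_cycle_subset_singleton:
  assumes "F \<subseteq> {e}"
  shows "\<not> is_cycle F vs"
proof
  assume c: "is_cycle F vs"
  then have len: "3 \<le> length vs" and d: "distinct vs"
    and ed: "\<And>k. k < length vs \<Longrightarrow> {vs ! k, vs ! (Suc k mod length vs)} = e"
    using assms unfolding is_cycle_def by auto
  have "{vs ! 0, vs ! 1} = {vs ! 1, vs ! 2}"
    using trans[OF ed[of 0] ed[of 1, symmetric]] len by (simp add: numeral_2_eq_2 flip: length_greater_0_conv)
  moreover have "vs ! 0 \<noteq> vs ! 1" "vs ! 0 \<noteq> vs ! 2"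
    using nth_eq_iff_index_eq[OF d, of 0 1] nth_eq_iff_index_eq[OF d, of 0 2] len
    by (simp_all flip: length_greater_0_conv)
  ultimately show False by (auto simp: doubleton_eq_iff)
qed

lemma acyclic_edges_subset_singleton: "F \<subseteq> {e} \<Longrightarrow> acyclic_edges F"
  using not_is_cycle_subset_singleton by (auto simp: acyclic_edges_def)

text \<open>The empty set is not maximal, since a single edge is acyclic. This later absorbs the
  additive 1 of the time bound into a multiple of \<open>card T\<close>.\<close>

lemma card_spanning_forest_pos:
  assumes "spanning_forest E T" "finite E" "E \<noteq> {}"
  shows "0 < card T"
proof -
  have "T \<noteq> {}"
    using assms acyclic_edges_subset_singleton by (auto simp: spanning_forest_def)
  moreover have "finite T"
    using assms by (auto simp: spanning_forest_def intro: finite_subset)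
  ultimately show ?thesis by (simp add: card_gt_0_iff)
qed

section \<open>The binary tree of IDs\<close>

datatype query = Single nat | Prefix nat

text \<open>Every positive number is a node, with children \<open>2 * v\<close> and
  \<open>2 * v + 1\<close>. For \<open>v > 0\<close>, \<open>i div 2 ^ k = v\<close> says that the
  binary expansion of \<open>v\<close> is a prefix of that of \<open>i\<close>, so
  \<open>Prefix v\<close> is the subtree at \<open>v\<close>. Inner nodes are IDs as well, hence the
  separate query \<open>Single v\<close>.\<close>

primrec ids :: "query \<Rightarrow> nat set" where
  "ids (Single v) = {v}"
| "ids (Prefix v) = {i. \<exists>k. i div 2 ^ k = v}"

text \<open>The empty list is a mere default: a query for one station never collides.\<close>

primrec children :: "query \<Rightarrow> query list" where
  "children (Single v) = []"
| "children (Prefix v) = [Single v, Prefix (2 * v), Prefix (2 * v + 1)]"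

lemma ids_Prefix_ge: "i \<in> ids (Prefix v) \<Longrightarrow> v \<le> i"
  by auto

text \<open>If \<open>v\<close> arises from \<open>i\<close> by dropping \<open>k > 0\<close> bits,
  then dropping one bit fewer leads to a child of \<open>v\<close>.\<close>

lemma ids_Prefix_split:
  assumes "i \<in> ids (Prefix v)"
  shows "i = v \<or> i \<in> ids (Prefix (2 * v)) \<or> i \<in> ids (Prefix (2 * v + 1))"
proof -
  obtain k where k: "i div 2 ^ k = v" using assms by auto
  show ?thesis
  proof (cases k)
    case 0
    then show ?thesis using k by simp
  next
    case (Suc j)
    then have "i div 2 ^ j div 2 = v" using k by (simp add: div_mult2_eq power_Suc2 del: power_Suc)
    then have "i div 2 ^ j = 2 * v \<or> i div 2 ^ j = 2 * v + 1" by linarith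
    then show ?thesis by auto
  qed
qed

text \<open>Repeated halving of a positive number reaches 1. Hence the initial query covers all
  stations whatever \<open>m\<close> is.\<close>

lemma ids_Prefix_1: "0 < i \<Longrightarrow> i \<in> ids (Prefix 1)"
proof (induction i rule: less_induct)
  case (less i)
  show ?case
  proof (cases "i = 1")
    case True
    then show ?thesis by (auto intro: exI[of _ 0])
  next
    case False
    then have "i div 2 \<in> ids (Prefix 1)" using less by simp
    then obtain k where "i div 2 div 2 ^ k = 1" by auto
    then have "i div 2 ^ Suc k = 1" by (simp add: div_mult2_eq)
    then show ?thesis by (auto simp del: power_Suc)
  qed
qed

section \<open>The algorithm\<close>

definition active :: "edge set \<Rightarrow> edge \<Rightarrow> bool" where
  "active F e \<longleftrightarrow> e \<notin> F \<and> acyclic_edges (insert e F)"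

lemma active_antimono: "active G e \<Longrightarrow> F \<subseteq> G \<Longrightarrow> active F e"
  unfolding active_def using acyclic_edges_mono[of "insert e G" "insert e F"] by blast

type_synonym state = "edge set \<times> query list"

fun next_state :: "feedback \<Rightarrow> state \<Rightarrow> state" where
  "next_state f (F, []) = (F, [])"
| "next_state Silence (F, q # s) = (F, s)"
| "next_state (Heard x) (F, q # s) = (insert (the (announced x)) F, s)"
| "next_state Collision (F, q # s) = (F, children q @ s)"

text \<open>The state is computed from the common feedback alone, so all stations agree on the
  forest and on the stack of pending queries, and they halt together.\<close>

definition state_of :: "feedback list \<Rightarrow> state" where
  "state_of h = fold next_state h ({}, [Prefix 1])"

definition forest_algorithm :: algorithm where
  "forest_algorithm n i e h = (case state_of h of
     (F, []) \<Rightarrow> Halt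
   | (F, q # s) \<Rightarrow> if i \<in> ids q \<and> active F e then Broadcast (Message (Some e) []) else Listen)"

section \<open>Evolution of the shared state during an execution\<close>

locale execution =
  fixes n m :: nat and \<sigma> :: "nat \<Rightarrow> edge"
begin

abbreviation "hist \<equiv> history forest_algorithm n m \<sigma>"

abbreviation "reveal \<equiv> revealed forest_algorithm n m \<sigma>"

definition forest :: "nat \<Rightarrow> edge set" where
  "forest t = fst (state_of (hist t))"

definition stack :: "nat \<Rightarrow> query list" where
  "stack t = snd (state_of (hist t))"

text \<open>If \<open>q\<close> is on top of the stack at time \<open>t\<close>, these are the
  stations that broadcast.\<close>

definition candidates :: "nat \<Rightarrow> query \<Rightarrow> nat set" where
  "candidates t q = {i \<in> {1..m} \<inter> ids q. active (forest t) (\<sigma> i)}"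

lemma state_of_hist: "state_of (hist t) = (forest t, stack t)"
  by (simp add: forest_def stack_def)

lemma start: "forest 0 = {}" "stack 0 = [Prefix 1]"
  by (simp_all add: forest_def stack_def state_of_def)

lemma forest_algorithm_hist:
  "forest_algorithm n i e (hist t) = (case stack t of
     [] \<Rightarrow> Halt
   | q # s \<Rightarrow> if i \<in> ids q \<and> active (forest t) e then Broadcast (Message (Some e) []) else Listen)"
  by (simp add: forest_algorithm_def state_of_hist)

lemma broadcasts_hist:
  assumes "stack t = q # s"
  shows "broadcasts forest_algorithm n m \<sigma> (hist t) =
           (\<lambda>i. (i, Message (Some (\<sigma> i)) [])) ` candidates t q"
  using assms by (auto simp: broadcasts_def forest_algorithm_hist candidates_def split: if_splits)

lemma state_Suc:
  "(forest (Suc t), stack (Suc t)) =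
     next_state (channel (broadcasts forest_algorithm n m \<sigma> (hist t))) (forest t, stack t)"
  by (simp add: state_of_hist[symmetric] state_of_def)

lemma step_silence:
  assumes "stack t = q # s" "candidates t q = {}"
  shows "forest (Suc t) = forest t" "stack (Suc t) = s"
  using state_Suc[of t] broadcasts_hist[OF assms(1)] assms by (simp_all add: channel_def)

lemma step_heard:
  assumes "stack t = q # s" "candidates t q = {i}"
  shows "forest (Suc t) = insert (\<sigma> i) (forest t)" "stack (Suc t) = s" "\<sigma> i \<in> reveal (Suc t)"
proof -
  have b: "broadcasts forest_algorithm n m \<sigma> (hist t) = {(i, Message (Some (\<sigma> i)) [])}"
    using broadcasts_hist[OF assms(1)] assms(2) by simp
  show "forest (Suc t) = insert (\<sigma> i) (forest t)" "stack (Suc t) = s"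
    using state_Suc[of t] assms(1) by (simp_all add: channel_def b)
  show "\<sigma> i \<in> reveal (Suc t)"
    unfolding revealed_def using b by force
qed

lemma step_collision:
  assumes "stack t = q # s" "candidates t q \<noteq> {}" "\<not> is_singleton (candidates t q)"
  shows "forest (Suc t) = forest t" "stack (Suc t) = children q @ s"
proof -
  \<comment> \<open>The ID is a component of each pair, so the number of candidates alone decides
    between a heard message and a collision.\<close>
  have "inj_on (\<lambda>i. (i, Message (Some (\<sigma> i)) [])) (candidates t q)"
    by (auto intro: inj_onI)
  then have "\<not> is_singleton ((\<lambda>i. (i, Message (Some (\<sigma> i)) [])) ` candidates t q)"
    using assms(3) by (simp add: is_singleton_altdef card_image)
  then show "forest (Suc t) = forest t" "stack (Suc t) = children q @ s"
    using state_Suc[of t] broadcasts_hist[OF assms(1)] assms(1,2)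
    by (simp_all add: channel_def)
qed

lemma step_cases [consumes 1, case_names silence heard collision]:
  assumes "stack t = q # s"
  obtains
    "candidates t q = {}" "forest (Suc t) = forest t" "stack (Suc t) = s"
  | i where "candidates t q = {i}" "forest (Suc t) = insert (\<sigma> i) (forest t)" "stack (Suc t) = s"
      "\<sigma> i \<in> reveal (Suc t)"
  | "candidates t q \<noteq> {}" "\<not> is_singleton (candidates t q)" "forest (Suc t) = forest t"
      "stack (Suc t) = children q @ s"
  using step_silence[OF assms] step_heard[OF assms] step_collision[OF assms]
  by (metis is_singletonE)

lemma forest_Suc_Nil: "stack t = [] \<Longrightarrow> forest (Suc t) = forest t"
  using state_Suc[of t] by simp

lemma forest_Suc_mono: "forest t \<subseteq> forest (Suc t)"
proof (cases "stack t")
  case Nil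
  then show ?thesis by (simp add: forest_Suc_Nil)
next
  case (Cons q s)
  then show ?thesis by (cases rule: step_cases) auto
qed

lemma forest_mono: "t \<le> u \<Longrightarrow> forest t \<subseteq> forest u"
  using forest_Suc_mono by (rule lift_Suc_mono_le)

text \<open>The forest changes only when a sole broadcaster is heard; it is active and announces its
  own edge.\<close>

lemma forest_invariant:
  "acyclic_edges (forest t) \<and> forest t \<subseteq> \<sigma> ` {1..m} \<and> forest t \<subseteq> reveal t"
proof (induction t)
  case 0
  then show ?case by (simp add: start acyclic_edges_subset_singleton)
next
  case (Suc t)
  have r: "reveal t \<subseteq> reveal (Suc t)"
    unfolding revealed_def by (auto intro: less_SucI)
  show ?case
  proof (cases "stack t")
    case Nil
    then show ?thesis using Suc r by (auto simp: forest_Suc_Nil)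
  next
    case (Cons q s)
    then show ?thesis
    proof (cases rule: step_cases)
      case (heard i)
      then have "i \<in> {1..m}" "acyclic_edges (insert (\<sigma> i) (forest t))"
        unfolding candidates_def active_def by auto
      then show ?thesis using heard Suc r by auto
    qed (use Suc r in auto)
  qed
qed

lemma finite_forest: "finite (forest t)"
  using forest_invariant[of t] by (intro finite_surj[of "{1..m}" _ \<sigma>]) auto

lemma card_forest_mono: "t \<le> u \<Longrightarrow> card (forest t) \<le> card (forest u)"
  by (simp add: card_mono finite_forest forest_mono)

section \<open>Settled subtrees and the cost of visiting them\<close>

definition settled :: "nat \<Rightarrow> query \<Rightarrow> bool" where
  "settled t q \<longleftrightarrow> candidates t q = {}"

text \<open>The forest only grows, and an inactive edge stays inactive. Thus subtrees settled at
  different times can be combined at the latest of them.\<close>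

lemma settled_mono: "settled t q \<Longrightarrow> t \<le> u \<Longrightarrow> settled u q"
  using active_antimono[OF _ forest_mono[of t u]] by (auto simp: settled_def candidates_def)

lemma settled_Suc:
  assumes "stack t = q # s" "candidates t q = {} \<or> is_singleton (candidates t q)"
  shows "settled (Suc t) q \<and> stack (Suc t) = s"
  using assms(1)
proof (cases rule: step_cases)
  case silence
  then show ?thesis by (simp add: settled_def candidates_def)
next
  case (heard i)
  have "candidates (Suc t) q \<subseteq> candidates t q"
    using active_antimono[OF _ forest_Suc_mono[of t]] by (auto simp: candidates_def)
  \<comment> \<open>The condition \<open>e \<notin> F\<close> in \<open>active\<close> silences a
    station once its edge has been revealed.\<close>
  moreover have "i \<notin> candidates (Suc t) q"
    using heard by (simp add: candidates_def active_def)
  ultimately show ?thesis using heard by (auto simp: settled_def)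
qed (use assms in auto)

lemma settled_Suc_Single:
  assumes "stack t = Single v # s"
  shows "settled (Suc t) (Single v) \<and> stack (Suc t) = s"
proof -
  have "candidates t (Single v) = {} \<or> candidates t (Single v) = {v}"
    unfolding candidates_def by auto
  then show ?thesis using settled_Suc[OF assms] by auto
qed

lemma settled_Prefix:
  assumes "settled t (Single v)" "settled t (Prefix (2 * v))" "settled t (Prefix (2 * v + 1))"
  shows "settled t (Prefix v)"
  using assms ids_Prefix_split[of _ v]
  unfolding settled_def candidates_def by (simp del: ids.simps(2)) blast

text \<open>
  The potential \<open>card (forest u)\<close> carries the factor \<open>3 * d\<close>, because each new edge pays for the
  three extra visits caused by a collision at each of the at most \<open>d\<close> levels above its station.
\<close>

lemma Prefix_cost:
  assumes "stack t = Prefix v # s" "m < v * 2 ^ d"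
  shows "\<exists>u>t. stack u = s \<and> settled u (Prefix v) \<and> (\<forall>w\<in>{t..<u}. stack w \<noteq> []) \<and>
           u + 2 \<le> t + 3 * 2 ^ d \<and> u + 3 * d * card (forest t) \<le> t + 1 + 3 * d * card (forest u)"
  using assms
proof (induction d arbitrary: t v s)
  case 0
  \<comment> \<open>For \<open>d = 0\<close> the node \<open>v\<close> exceeds \<open>m\<close>, and
    all IDs below it are at least \<open>v\<close>.\<close>
  have "candidates t (Prefix v) = {}"
    using 0 ids_Prefix_ge unfolding candidates_def by fastforce
  then have "settled (Suc t) (Prefix v) \<and> stack (Suc t) = s \<and> forest (Suc t) = forest t"
    using settled_Suc step_silence 0 by blast
  then show ?case using 0 by (intro exI[of _ "Suc t"]) auto
next
  case (Suc d)
  show ?case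
  proof (cases "candidates t (Prefix v) = {} \<or> is_singleton (candidates t (Prefix v))")
    case True
    then have "settled (Suc t) (Prefix v) \<and> stack (Suc t) = s"
      using settled_Suc Suc.prems by blast
    moreover have "card (forest t) \<le> card (forest (Suc t))" by (simp add: card_forest_mono)
    then have "3 * Suc d * card (forest t) \<le> 3 * Suc d * card (forest (Suc t))"
      by (rule mult_le_mono2)
    moreover have "(1::nat) \<le> 2 ^ Suc d" by simp
    then have "Suc t + 2 \<le> t + 3 * 2 ^ Suc d" by linarith
    moreover have "\<forall>w\<in>{t..<Suc t}. stack w \<noteq> []" using Suc.prems by auto
    ultimately show ?thesis by (intro exI[of _ "Suc t"]) linarith
  next
    case False
    let ?L = "Prefix (2 * v)" and ?R = "Prefix (2 * v + 1)"
    let ?t = "Suc (Suc t)"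
    have s1: "stack (Suc t) = Single v # ?L # ?R # s"
      using False step_collision(2)[OF Suc.prems(1)] by simp
    have s2: "settled ?t (Single v)" "stack ?t = ?L # ?R # s"
      using settled_Suc_Single[OF s1] by auto
    have "m < (2 * v) * 2 ^ d" "m < (2 * v + 1) * 2 ^ d"
      using Suc.prems(2) by (simp_all add: algebra_simps)
    note IH = Suc.IH[OF _ this(1)] Suc.IH[OF _ this(2)]
    obtain x where x: "?t < x" "stack x = ?R # s" "settled x ?L" "\<forall>w\<in>{?t..<x}. stack w \<noteq> []"
      "x + 2 \<le> ?t + 3 * 2 ^ d"
      "x + 3 * d * card (forest ?t) \<le> ?t + 1 + 3 * d * card (forest x)"
      using IH(1)[OF s2(2)] by (elim exE conjE) (rule that)
    obtain u where u: "x < u" "stack u = s" "settled u ?R" "\<forall>w\<in>{x..<u}. stack w \<noteq> []"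
      "u + 2 \<le> x + 3 * 2 ^ d"
      "u + 3 * d * card (forest x) \<le> x + 1 + 3 * d * card (forest u)"
      using IH(2)[OF x(2)] by (elim exE conjE) (rule that)
    have settled: "settled u (Prefix v)"
      using s2(1) x(1,3) u(1,3) by (meson settled_Prefix settled_mono less_imp_le less_trans)
    \<comment> \<open>The collision shows active stations below \<open>v\<close> at time
      \<open>t\<close>, while none is left at time \<open>u\<close>.\<close>
    have "forest t \<noteq> forest u"
      using False settled unfolding settled_def candidates_def by auto
    then have grow: "Suc (card (forest t)) \<le> card (forest u)"
      using forest_mono[of t u] finite_forest[of u] x(1) u(1)
      by (simp add: Suc_leI psubset_card_mono psubset_eq)
    have "3 * d * card (forest t) \<le> 3 * d * card (forest ?t)"
      by (intro mult_le_mono2 card_forest_mono) simp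
    \<comment> \<open>Beyond the terms with factor \<open>3 * d\<close>, the collision, the query
      \<open>Single v\<close> and the additive 1 of each child sum to 4. One of these is allowed
      again; the other three are paid for by the edge gained in \<open>grow\<close>.\<close>
    then have "u + 3 * Suc d * card (forest t) \<le> t + 1 + 3 * Suc d * card (forest u)"
      using x(6) u(6) grow unfolding mult_Suc_right add_mult_distrib by linarith
    moreover have "stack w \<noteq> []" if w: "w \<in> {t..<u}" for w
    proof -
      consider "w = t" | "w = Suc t" | "w \<in> {?t..<x}" | "w \<in> {x..<u}"
        using w by fastforce
      then show ?thesis using Suc.prems(1) s1 x(4) u(4) by cases auto
    qed
    \<comment> \<open>Two steps for \<open>v\<close> plus at most \<open>3 * 2 ^ d - 2\<close> for
      each child give \<open>3 * 2 ^ Suc d - 2\<close>; the slack 2 makes the induction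
      close.\<close>
    moreover have "u + 2 \<le> t + 3 * 2 ^ Suc d"
      using x(5) u(5) by simp
    ultimately show ?thesis using settled u x(1) by (intro exI[of _ u]) auto
  qed
qed

text \<open>When the stack is empty the root is settled, and every ID lies below the root, so no
  edge outside the forest is still active. The number \<open>d\<close> enters only the analysis, not
  the algorithm.\<close>

lemma execution_result:
  assumes "0 < m" "m < 2 ^ d" "card (\<sigma> ` {1..m}) = m"
  shows "\<exists>t. finds_spanning_forest forest_algorithm n (\<sigma> ` {1..m}) \<sigma> (forest t) t \<and>
           t \<le> 3 * 2 ^ d \<and> t \<le> 1 + 3 * d * card (forest t)"
proof -
  obtain t where t: "stack t = []" "settled t (Prefix 1)" "\<forall>w\<in>{0..<t}. stack w \<noteq> []"
    "t + 2 \<le> 0 + 3 * 2 ^ d" "t + 3 * d * card (forest 0) \<le> 0 + 1 + 3 * d * card (forest t)"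
    using Prefix_cost[OF start(2), of d] assms(2) by auto
  have "\<not> acyclic_edges (insert e (forest t))" if e: "e \<in> \<sigma> ` {1..m} - forest t" for e
  proof -
    obtain i where i: "i \<in> {1..m}" "e = \<sigma> i" using e by blast
    then have "\<not> active (forest t) e"
      using t(2) ids_Prefix_1[of i] unfolding settled_def candidates_def by auto
    then show ?thesis using e by (simp add: active_def)
  qed
  then have "spanning_forest (\<sigma> ` {1..m}) (forest t)"
    using forest_invariant[of t] by (simp add: spanning_forest_def)
  moreover have "forest_algorithm n i e (hist w) \<noteq> Halt" if "w < t" for i e w
    using t(3) that by (auto simp: forest_algorithm_hist split: list.split)
  \<comment> \<open>Since \<open>0 < m\<close>, some station exists, and its not halting before
    \<open>t\<close> also refutes the earlier \<open>all_halt\<close>.\<close>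
  then have "terminates_after forest_algorithm n m \<sigma> t"
    using t(1) assms(1)
    by (auto simp: terminates_after_def all_halt_def forest_algorithm_hist Suc_le_eq)
  ultimately show ?thesis
    using forest_invariant[of t] t(4,5) assms(3)
    by (intro exI[of _ t]) (auto simp: finds_spanning_forest_def)
qed

end

section \<open>The asymptotic bound\<close>

lemma binary_length_exists:
  assumes "0 < m"
  obtains d where "m < 2 ^ d" "2 ^ d \<le> 2 * m" "real d \<le> 2 * log_bound m"
proof -
  obtain k where k: "2 ^ k \<le> m" "m < 2 ^ (k + 1)"
    using ex_power_ivl1[of 2 m] assms by auto
  have "real k \<le> log 2 (real m)"
    using k(1) assms by (simp add: le_log_iff powr_realpow)
  \<comment> \<open>Both \<open>k\<close> and 1 are at most \<open>log_bound m\<close>.\<close>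
  then have "real (k + 1) \<le> 2 * log_bound m"
    by (simp add: log_bound_def)
  with k show thesis by (intro that[of "k + 1"]) auto
qed

theorem theorem1:
  "\<exists>(A :: algorithm) (C :: real). C > 0 \<and>
     (\<forall>(n :: nat) (E :: edge set) (\<sigma> :: nat \<Rightarrow> edge).
        simple_graph n E \<longrightarrow> bij_betw \<sigma> {1..card E} E \<longrightarrow>
        (\<exists>T t. finds_spanning_forest A n E \<sigma> T t \<and>
               real t \<le> C * min (real (card E)) (real (card T) * log_bound (card E))))"
proof (intro exI[of _ forest_algorithm] exI[of _ "8::real"] conjI allI impI)
  fix n :: nat and E :: "edge set" and \<sigma> :: "nat \<Rightarrow> edge"
  assume bij: "bij_betw \<sigma> {1..card E} E"
  let ?m = "card E"
  have img: "\<sigma> ` {1..?m} = E" using bij by (simp add: bij_betw_def)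
  show "\<exists>T t. finds_spanning_forest forest_algorithm n E \<sigma> T t \<and>
               real t \<le> 8 * min (real ?m) (real (card T) * log_bound ?m)"
  proof (cases "?m = 0")
    case True
    then have "E = {}" using img by simp
    \<comment> \<open>Without stations, \<open>all_halt\<close> holds vacuously at time 0.\<close>
    then have "finds_spanning_forest forest_algorithm n E \<sigma> {} 0"
      by (simp add: finds_spanning_forest_def spanning_forest_def terminates_after_def
          all_halt_def acyclic_edges_subset_singleton)
    then show ?thesis using True by (intro exI[of _ "{}"] exI[of _ 0]) simp
  next
    case False
    then obtain d where d: "?m < 2 ^ d" "2 ^ d \<le> 2 * ?m" "real d \<le> 2 * log_bound ?m"
      using binary_length_exists by auto
    interpret execution n ?m \<sigma> .
    obtain t where t: "finds_spanning_forest forest_algorithm n E \<sigma> (forest t) t"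
      "t \<le> 3 * 2 ^ d" "t \<le> 1 + 3 * d * card (forest t)"
      using execution_result[OF _ d(1)] False img by auto
    have f: "0 < card (forest t)"
      using t(1) False card_spanning_forest_pos[of E "forest t"]
      by (auto simp: finds_spanning_forest_def card_eq_0_iff)
    \<comment> \<open>Here \<open>3 * 2 ^ d\<close> is at most \<open>6 * ?m\<close>.\<close>
    have "real t \<le> 8 * real ?m" using t(2) d(2) by linarith
    moreover have "real t \<le> 8 * (real (card (forest t)) * log_bound ?m)"
    proof -
      have "0 < d" using d(1) False by (cases d) auto
      then have "1 \<le> d * card (forest t)" using f by (simp add: Suc_leI)
      \<comment> \<open>The additive 1 is absorbed, turning the factor 3 into 4; the bound on
        \<open>d\<close> by \<open>2 * log_bound ?m\<close> then yields the constant 8.\<close>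
      then have "t \<le> 4 * (d * card (forest t))" using t(3) unfolding mult.assoc by linarith
      then have "real t \<le> 4 * (real d * real (card (forest t)))"
        by (metis of_nat_le_iff of_nat_mult of_nat_numeral)
      also have "\<dots> \<le> 4 * (2 * log_bound ?m * real (card (forest t)))"
        using d(3) by (intro mult_left_mono mult_right_mono) auto
      finally show ?thesis by (simp add: mult_ac)
    qed
    ultimately show ?thesis using t(1) by (intro exI[of _ "forest t"] exI[of _ t]) simp
  qed
qed simp

end
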